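(* Consider the 16 composite operators $A\mapsto A^\sigma_\rho:=(A^\sigma)_\rho$ on $P(G)$, with $\sigma,\rho\in\{\Delta,\Pi,N,\nabla\}$, associated to a formal context $(G,M,R)$. Out of these 16, only $(-)^\Delta_\Delta$ and $(-)^\Pi_N$ are closure operators. That is: for every formal context $(G,M,R)$ the operators $(-)^\Delta_\Delta$ and $(-)^\Pi_N$ are closure operators on $P(G)$; and for each of the other 14 pairs $(\sigma,\rho)$ there is a formal context $(G,M,R)$ for which $(-)^\sigma_\rho$ is not a closure operator on $P(G)$.
   Context: A formal context $(G,M,R)$ consists of two sets $G,M$ and a relation $R\subseteq G\times M$; write $gRm$ for $(g,m)\in R$ and $g\overline{R}m$ for $\neg(gRm)$. Power sets are ordered by inclusion. For $A\subseteq G$: $A^\Delta=\{m\in M\mid\forall g\in G,\ g\in A\Rightarrow gRm\}$, $A^\Pi=\{m\in M\mid\exists g\in G,\ g\in A\wedge gRm\}$, $A^N=\{m\in M\mid\forall g\in G,\ gRm\Rightarrow g\in A\}$, $A^\nabla=\{m\in M\mid\exists g\in G,\ g\notin A\wedge g\overline{R}m\}$. For $B\subseteq M$: $B_\Delta=\{g\in G\mid\forall m\in M,\ m\in B\Rightarrow gRm\}$, $B_\Pi=\{g\in G\mid\exists m\in M,\ m\in B\wedge gRm\}$, $B_N=\{g\in G\mid\forall m\in M,\ gRm\Rightarrow m\in B\}$, $B_\nabla=\{g\in G\mid\exists m\in M,\ m\notin B\wedge g\overline{R}m\}$. A map $F\colon\mathcal{C}\to\mathcal{C}$ on a poset is a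 closure operator if it is extensive ($A\le F(A)$), monotone ($A\le A'\Rightarrow F(A)\le F(A')$) and idempotent ($F(F(A))=F(A)$). *)

theory Defs
  imports Main
begin

definition formal_context :: "'a set \<Rightarrow> 'b set \<Rightarrow> ('a \<times> 'b) set \<Rightarrow> bool" where
  "formal_context G M R \<longleftrightarrow> R \<subseteq> G \<times> M"

datatype derivation = Delta | Poss | Nec | Nabla
  (* the superscripts/subscripts \<Delta>, \<Pi>, N, \<nabla> *)

fun up :: "derivation \<Rightarrow> 'a set \<Rightarrow> 'b set \<Rightarrow> ('a \<times> 'b) set \<Rightarrow> 'a set \<Rightarrow> 'b set" where
  "up Delta G M R A = {m \<in> M. \<forall>g\<in>G. g \<in> A \<longrightarrow> (g, m) \<in> R}"
| "up Poss G M R A = {m \<in> M. \<exists>g\<in>G. g \<in> A \<and> (g, m) \<in> R}"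
| "up Nec G M R A = {m \<in> M. \<forall>g\<in>G. (g, m) \<in> R \<longrightarrow> g \<in> A}"
| "up Nabla G M R A = {m \<in> M. \<exists>g\<in>G. g \<notin> A \<and> (g, m) \<notin> R}"

fun down :: "derivation \<Rightarrow> 'a set \<Rightarrow> 'b set \<Rightarrow> ('a \<times> 'b) set \<Rightarrow> 'b set \<Rightarrow> 'a set" where
  "down Delta G M R B = {g \<in> G. \<forall>m\<in>M. m \<in> B \<longrightarrow> (g, m) \<in> R}"
| "down Poss G M R B = {g \<in> G. \<exists>m\<in>M. m \<in> B \<and> (g, m) \<in> R}"
| "down Nec G M R B = {g \<in> G. \<forall>m\<in>M. (g, m) \<in> R \<longrightarrow> m \<in> B}"
| "down Nabla G M R B = {g \<in> G. \<exists>m\<in>M. m \<notin> B \<and> (g, m) \<notin> R}"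

definition composite ::
    "derivation \<Rightarrow> derivation \<Rightarrow> 'a set \<Rightarrow> 'b set \<Rightarrow> ('a \<times> 'b) set \<Rightarrow> 'a set \<Rightarrow> 'a set" where
  "composite \<sigma> \<rho> G M R A = down \<rho> G M R (up \<sigma> G M R A)"

definition closure_operator_on :: "'c::order set \<Rightarrow> ('c \<Rightarrow> 'c) \<Rightarrow> bool" where
  "closure_operator_on C F \<longleftrightarrow>
     F ` C \<subseteq> C \<and>
     (\<forall>x\<in>C. x \<le> F x) \<and>
     mono_on C F \<and>
     (\<forall>x\<in>C. F (F x) = F x)"

end

theory Submission
  imports Defs
begin

text \<open>
  Both positive cases come from Galois connections between subsets of \<open>G\<close> and subsets of \<open>M\<close>:
  \<open>A \<subseteq> B\<^sub>\<Delta>\<close> iff \<open>B \<subseteq> A\<^sup>\<Delta>\<close>, and \<open>A\<^sup>\<Pi> \<subseteq> B\<close> iff \<open>A \<subseteq> B\<^sub>N\<close>.  The round trip of a Galois connection,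
  started on the side where it is inflationary, is a closure operator.

  For the negative cases a single context with one attribute refutes all fourteen operators, and it
  is always extensivity that fails.  Let four objects be split evenly into two that have the
  attribute, \<open>0\<close> and \<open>1\<close>, and two that lack it, \<open>2\<close> and \<open>3\<close>.  A set \<open>A\<close> is
  seen by an up-operator only as a yes or no for the attribute, and the down-operator can answer only
  with the empty set, one of the two halves, or everything.  The set \<open>{0, 2}\<close> meets both
  halves without containing either, so it lies in the result only when that result is
  everything.  That happens for the two closure operators and for \<open>(N, \<Delta>)\<close> and \<open>(\<nabla>, N)\<close>
  alone; the latter two send the full object set to one half.
\<close>

text \<open>
  This is the usual one-line characterization of closure operators; it is the form in which a
  Galois connection delivers them, since both sides say that the polar of \<open>x\<close> is comparable with
  the polar of \<open>y\<close>.
\<close>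

lemma closure_operator_onI:
  assumes closed: "\<And>x. x \<in> C \<Longrightarrow> F x \<in> C"
    and le_iff: "\<And>x y. x \<in> C \<Longrightarrow> y \<in> C \<Longrightarrow> x \<le> F y \<longleftrightarrow> F x \<le> F y"
  shows "closure_operator_on C F"
proof -
  have ext: "x \<le> F x" if "x \<in> C" for x
    using le_iff[OF that that] by simp
  have "F x \<le> F y" if "x \<in> C" "y \<in> C" "x \<le> y" for x y
    using le_iff ext that order_trans by metis
  moreover have "F (F x) = F x" if "x \<in> C" for x
    using le_iff[of "F x" x] ext[of "F x"] closed that by (simp add: order_antisym)
  ultimately show ?thesis
    using closed ext by (auto simp: closure_operator_on_def mono_on_def)
qed

lemma galois_Delta:
  assumes "A \<subseteq> G" "B \<subseteq> M"
  shows "A \<subseteq> down Delta G M R B \<longleftrightarrow> B \<subseteq> up Delta G M R A"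
  using assms by auto

lemma galois_Poss_Nec:
  assumes "A \<subseteq> G" "B \<subseteq> M"
  shows "up Poss G M R A \<subseteq> B \<longleftrightarrow> A \<subseteq> down Nec G M R B"
  using assms by auto

lemma up_subset: "up \<sigma> G M R A \<subseteq> M"
  by (cases \<sigma>) auto

lemma down_subset: "down \<rho> G M R B \<subseteq> G"
  by (cases \<rho>) auto

lemma closure_operator_Delta_Delta:
  "closure_operator_on (Pow G) (composite Delta Delta G M R)"
proof (rule closure_operator_onI)
  fix A A' assume "A \<in> Pow G" "A' \<in> Pow G"
  \<comment> \<open>Comparing polars is comparing their down-images: the polar is recovered by going up again.\<close>
  then have "up Delta G M R A' \<subseteq> up Delta G M R A \<longleftrightarrow>
      down Delta G M R (up Delta G M R A) \<subseteq> down Delta G M R (up Delta G M R A')"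
    by auto
  then show "A \<subseteq> composite Delta Delta G M R A' \<longleftrightarrow>
      composite Delta Delta G M R A \<subseteq> composite Delta Delta G M R A'"
    using \<open>A \<in> Pow G\<close> galois_Delta[OF _ up_subset, of A G M R Delta G R A']
    by (simp add: composite_def del: up.simps down.simps)
qed (simp add: composite_def down_subset del: up.simps down.simps)

lemma closure_operator_Poss_Nec:
  "closure_operator_on (Pow G) (composite Poss Nec G M R)"
proof (rule closure_operator_onI)
  fix A A' assume "A \<in> Pow G" "A' \<in> Pow G"
  \<comment> \<open>Comparing polars is comparing their down-images: the polar is recovered by going up again.\<close>
  then have "up Poss G M R A \<subseteq> up Poss G M R A' \<longleftrightarrow>
      down Nec G M R (up Poss G M R A) \<subseteq> down Nec G M R (up Poss G M R A')"
    by auto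
  then show "A \<subseteq> composite Poss Nec G M R A' \<longleftrightarrow>
      composite Poss Nec G M R A \<subseteq> composite Poss Nec G M R A'"
    using \<open>A \<in> Pow G\<close> galois_Poss_Nec[OF _ up_subset, of A G M R Poss G R A']
    by (simp add: composite_def del: up.simps down.simps)
qed (simp add: composite_def down_subset del: up.simps down.simps)

lemma not_closure_operator_onI:
  assumes "x \<in> C" "\<not> x \<le> F x"
  shows "\<not> closure_operator_on C F"
  using assms by (auto simp: closure_operator_on_def)

lemma half_split_context_not_closure:
  fixes G M :: "nat set"
  assumes G: "G = {0, 1, 2, 3}" and M: "M = {0}" and R: "R = {(0, 0), (1, 0)}"
    and other: "(\<sigma>, \<rho>) \<notin> {(Delta, Delta), (Poss, Nec)}"
  shows "\<not> closure_operator_on (Pow G) (composite \<sigma> \<rho> G M R)"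
proof (cases "(\<sigma>, \<rho>) \<in> {(Nec, Delta), (Nabla, Nec)}")
  case True
  then have "\<not> G \<subseteq> composite \<sigma> \<rho> G M R G"
    by (auto simp: composite_def G M R)
  then show ?thesis
    by (intro not_closure_operator_onI) auto
next
  case False
  with other have "\<not> {0, 2} \<subseteq> composite \<sigma> \<rho> G M R {0, 2}"
    by (cases \<sigma>; cases \<rho>) (auto simp: composite_def G M R)
  then show ?thesis
    by (intro not_closure_operator_onI[of "{0, 2}"]) (auto simp: G)
qed

theorem mainTheorem2:
  shows "(\<forall>(G :: 'a set) (M :: 'b set) R. formal_context G M R \<longrightarrow>
            closure_operator_on (Pow G) (composite Delta Delta G M R) \<and>
            closure_operator_on (Pow G) (composite Poss Nec G M R)) \<and>
         (\<forall>\<sigma> \<rho>. (\<sigma>, \<rho>) \<notin> {(Delta, Delta), (Poss, Nec)} \<longrightarrow>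
            (\<exists>(G :: nat set) (M :: nat set) R. formal_context G M R \<and>
               \<not> closure_operator_on (Pow G) (composite \<sigma> \<rho> G M R)))"
proof (intro conjI allI impI)
  fix \<sigma> \<rho> assume "(\<sigma>, \<rho>) \<notin> {(Delta, Delta), (Poss, Nec)}"
  moreover have "formal_context {0, 1, 2, 3 :: nat} {0 :: nat} {(0, 0), (1, 0)}"
    by (simp add: formal_context_def)
  ultimately show "\<exists>(G :: nat set) (M :: nat set) R. formal_context G M R \<and>
      \<not> closure_operator_on (Pow G) (composite \<sigma> \<rho> G M R)"
    using half_split_context_not_closure[OF refl refl refl] by blast
qed (rule closure_operator_Delta_Delta closure_operator_Poss_Nec)+

end
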